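(* Let $(A,B)$ be a strict nondegenerate Hessenberg input normal (HIN) pair, with $A$ a real $n\times n$ matrix and $B$ a real $n\times d$ matrix. Then there are no other equivalent strict HIN pairs: if $(\tilde A,\tilde B)$ is a strict HIN pair equivalent to $(A,B)$, then $\tilde A=A$ and $\tilde B=B$.
   Context: All matrices are real; $A^*$ denotes the transpose of $A$. Two pairs $(A,B)$ and $(\tilde A,\tilde B)$ are equivalent if $\tilde A=T^{-1}AT$ and $\tilde B=T^{-1}B$ for some invertible $T$. A pair $(A,B)$ is input normal if $AA^*+BB^*=I_n$. A pair $(A,B)$ is in Hessenberg form if $A$ is an (upper) Hessenberg matrix ($A_{i,j}=0$ for $i>j+1$), $B_{1,1}\ge 0$, and $B_{j,1}=0$ for $j>1$. A Hessenberg input normal (HIN) pair is a pair that is both in Hessenberg form and input normal. A Hessenberg pair is nondegenerate if $|B_{1,1}|<1$. It is unreduced if $A_{i+1,i}\neq 0$ for $1\le i<n$ and $B_{1,1}\ne 0$. It is standard if $A_{i+1,i}\ge 0$ for $1\le i<n$ and $0\le B_{1,1}\le 1$. It is strict if it is unreduced and standard. *)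

theory Defs
  imports Complex_Main "Jordan_Normal_Form.Matrix"
begin

text \<open>
  A pair consists of a real \<open>n \<times> n\<close> matrix \<open>A\<close> and a real \<open>n \<times> d\<close> matrix \<open>B\<close> with
  \<open>n, d \<ge> 1\<close>; the dimensions are not part of the predicates below and are fixed by
  \<^const>\<open>carrier_mat\<close> where they are used.  Matrix indices start at 0, so the entry
  \<open>B\<^sub>1\<^sub>1\<close> of the usual notation is \<open>B $$ (0, 0)\<close>.
\<close>

text \<open>\<open>S\<close> is the inverse of \<open>T\<close>, which it determines uniquely.\<close>
definition equivalent_pairs ::
    "real mat \<Rightarrow> real mat \<Rightarrow> real mat \<Rightarrow> real mat \<Rightarrow> bool" where
  "equivalent_pairs A B A' B' \<longleftrightarrow>
     (\<exists>T S. T \<in> carrier_mat (dim_row A) (dim_row A) \<and>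
            S \<in> carrier_mat (dim_row A) (dim_row A) \<and>
            inverts_mat T S \<and> inverts_mat S T \<and>
            A' = S * A * T \<and> B' = S * B)"

definition input_normal :: "real mat \<Rightarrow> real mat \<Rightarrow> bool" where
  "input_normal A B \<longleftrightarrow>
     A * transpose_mat A + B * transpose_mat B = 1\<^sub>m (dim_row A)"

definition hessenberg_mat :: "real mat \<Rightarrow> bool" where
  "hessenberg_mat A \<longleftrightarrow>
     (\<forall>i < dim_row A. \<forall>j < dim_col A. i > j + 1 \<longrightarrow> A $$ (i, j) = 0)"

definition hessenberg_pair :: "real mat \<Rightarrow> real mat \<Rightarrow> bool" where
  "hessenberg_pair A B \<longleftrightarrow>
     hessenberg_mat A \<and> B $$ (0, 0) \<ge> 0 \<and>
     (\<forall>j < dim_row B. j > 0 \<longrightarrow> B $$ (j, 0) = 0)"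

definition HIN_pair :: "real mat \<Rightarrow> real mat \<Rightarrow> bool" where
  "HIN_pair A B \<longleftrightarrow> hessenberg_pair A B \<and> input_normal A B"

text \<open>
  The following are attributes of a pair that is already known to be in Hessenberg form.
\<close>

definition nondegenerate_pair :: "real mat \<Rightarrow> real mat \<Rightarrow> bool" where
  "nondegenerate_pair A B \<longleftrightarrow> \<bar>B $$ (0, 0)\<bar> < 1"

definition unreduced_pair :: "real mat \<Rightarrow> real mat \<Rightarrow> bool" where
  "unreduced_pair A B \<longleftrightarrow>
     (\<forall>i. i + 1 < dim_row A \<longrightarrow> A $$ (i + 1, i) \<noteq> 0) \<and> B $$ (0, 0) \<noteq> 0"

definition standard_pair :: "real mat \<Rightarrow> real mat \<Rightarrow> bool" where
  "standard_pair A B \<longleftrightarrow>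
     (\<forall>i. i + 1 < dim_row A \<longrightarrow> A $$ (i + 1, i) \<ge> 0) \<and>
     0 \<le> B $$ (0, 0) \<and> B $$ (0, 0) \<le> 1"

definition strict_pair :: "real mat \<Rightarrow> real mat \<Rightarrow> bool" where
  "strict_pair A B \<longleftrightarrow> unreduced_pair A B \<and> standard_pair A B"

end

theory Submission
  imports Defs
begin

text \<open>
  Subtracting the two normalisation identities shows that \<open>X = T T\<^sup>T - 1\<close> is a symmetric
  solution of \<open>X = A X A\<^sup>T\<close>.  With \<open>Y = A\<^sup>T X A\<close>, cyclicity of the trace gives
  \<open>|X - Y|\<^sup>2 + |X B|\<^sup>2 + |B\<^sup>T X A|\<^sup>2 = 0\<close> for the Frobenius norm, so \<open>X B = 0\<close> and \<open>X\<close> commutes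
  with \<open>A\<close>.  As the first basis vector is a multiple of a column of \<open>B\<close> and is cyclic for an
  unreduced Hessenberg matrix, \<open>X = 0\<close>: the equivalence \<open>T\<close> is orthogonal.  Finally
  \<open>T\<close> fixes the basis vectors one after the other (the uniqueness part of the implicit Q theorem),
  with the signs determined by the positive subdiagonals.
\<close>

section \<open>Traces, and \<open>trace_mat (M\<^sup>T * M)\<close> as the squared Frobenius
  norm\<close>

definition trace_mat :: "'a :: comm_monoid_add mat \<Rightarrow> 'a" where
  "trace_mat M = (\<Sum>i < dim_row M. M $$ (i, i))"

lemma trace_mat_mult_commute:
  fixes M N :: "'a :: comm_semiring_0 mat"
  assumes "M \<in> carrier_mat m n" and "N \<in> carrier_mat n m"
  shows "trace_mat (M * N) = trace_mat (N * M)"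
proof -
  have "trace_mat (M * N) = (\<Sum>i<m. \<Sum>k<n. M $$ (i, k) * N $$ (k, i))"
    using assms by (simp add: trace_mat_def scalar_prod_def atLeast0LessThan)
  also have "\<dots> = (\<Sum>k<n. \<Sum>i<m. N $$ (k, i) * M $$ (i, k))"
    by (subst sum.swap) (simp add: mult.commute)
  also have "\<dots> = trace_mat (N * M)"
    using assms by (simp add: trace_mat_def scalar_prod_def atLeast0LessThan)
  finally show ?thesis .
qed

lemma trace_mat_minus:
  fixes M N :: "'a :: ab_group_add mat"
  assumes "M \<in> carrier_mat n n" and "N \<in> carrier_mat n n"
  shows "trace_mat (M - N) = trace_mat M - trace_mat N"
  using assms by (simp add: trace_mat_def sum_subtractf)

lemma trace_transpose_mult_self:
  fixes M :: "real mat"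
  assumes "M \<in> carrier_mat m n"
  shows "trace_mat (M\<^sup>T * M) = (\<Sum>j<n. \<Sum>i<m. (M $$ (i, j))\<^sup>2)"
  using assms by (simp add: trace_mat_def scalar_prod_def atLeast0LessThan power2_eq_square)

lemma trace_transpose_mult_self_nonneg:
  fixes M :: "real mat"
  shows "trace_mat (M\<^sup>T * M) \<ge> 0"
  by (subst trace_transpose_mult_self[OF carrier_matI[OF refl refl]]) (intro sum_nonneg zero_le_power2)

lemma trace_transpose_mult_self_eq_0:
  fixes M :: "real mat"
  assumes M: "M \<in> carrier_mat m n" and "trace_mat (M\<^sup>T * M) = 0"
  shows "M = 0\<^sub>m m n"
proof -
  have "(\<Sum>j<n. \<Sum>i<m. (M $$ (i, j))\<^sup>2) = 0"
    using assms trace_transpose_mult_self by metis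
  then have "\<forall>j<n. \<forall>i<m. M $$ (i, j) = 0"
    by (simp add: sum_nonneg_eq_0_iff sum_nonneg)
  then show ?thesis
    using M by (intro eq_matI) auto
qed

section \<open>Symmetric solutions of the Stein equation\<close>

text \<open>In the Frobenius inner product, sending \<open>X\<close> to
  \<open>A\<^sup>T * X * A\<close> is the adjoint of sending \<open>X\<close> to
  \<open>A * X * A\<^sup>T\<close>. By normality the adjoint does not increase the norm of a
  symmetric \<open>X\<close>, the loss being the squared norms of \<open>X * B\<close> and
  \<open>C\<close>. A fixed point of the original map is thus fixed by the adjoint too, and the loss
  vanishes.\<close>

lemma symmetric_stein_solution_commutes:
  fixes A B X :: "real mat"
  assumes A[simp]: "A \<in> carrier_mat n n" and B[simp]: "B \<in> carrier_mat n d"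
    and X[simp]: "X \<in> carrier_mat n n"
    and normal: "A * A\<^sup>T + B * B\<^sup>T = 1\<^sub>m n"
    and sym: "X\<^sup>T = X" and stein: "A * X * A\<^sup>T = X"
  shows "X * B = 0\<^sub>m n d" and "X * A = A * X"
proof -
  define Y where "Y = A\<^sup>T * X * A"
  define C where "C = B\<^sup>T * X * A"
  note assoc = assoc_mult_mat
  note [simp] = mult_carrier_mat[of _ n n _ n] mult_carrier_mat[of _ n n _ d]
    mult_carrier_mat[of _ n d _ n] mult_carrier_mat[of _ d n _ n]
    left_mult_one_mat[of _ n n] right_mult_one_mat[of _ n n]
  have Y[simp]: "Y \<in> carrier_mat n n" and C[simp]: "C \<in> carrier_mat d n"
    by (simp_all add: Y_def C_def)
  have AA: "A * A\<^sup>T = 1\<^sub>m n - B * B\<^sup>T"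
  proof -
    have "A * A\<^sup>T = (A * A\<^sup>T + B * B\<^sup>T) - B * B\<^sup>T"
      using A B by (intro eq_matI) (auto simp del: A B)
    then show ?thesis by (simp add: normal)
  qed
  have symY: "Y\<^sup>T = Y"
    by (simp add: Y_def transpose_mult[of _ n n _ n] sym assoc[of _ n n _ n _ n])
  \<comment> \<open>A commutation relation with two defects: \<open>Y\<close> in place of
    \<open>X\<close>, and the term \<open>B * C\<close>. Both are shown to vanish below.\<close>
  have AY: "A * Y = X * A - B * C"
  proof -
    have "A * Y = (A * A\<^sup>T) * (X * A)"
      by (simp add: Y_def assoc[of _ n n _ n _ n])
    also have "\<dots> = X * A - (B * B\<^sup>T) * (X * A)"
      by (simp add: AA minus_mult_distrib_mat[of _ n n _ _ n])
    also have "(B * B\<^sup>T) * (X * A) = B * C"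
      by (simp add: C_def assoc[of _ n d _ n _ n] assoc[of _ d n _ n _ n])
    finally show ?thesis .
  qed
  have XY: "trace_mat (X * Y) = trace_mat (X * X)"
  proof -
    have "trace_mat (X * Y) = trace_mat ((X * A\<^sup>T) * (X * A))"
      by (simp add: Y_def assoc[of _ n n _ n _ n])
    also have "\<dots> = trace_mat ((X * A) * (X * A\<^sup>T))"
      by (rule trace_mat_mult_commute[of _ n n]) auto
    also have "(X * A) * (X * A\<^sup>T) = X * (A * X * A\<^sup>T)"
      by (simp add: assoc[of _ n n _ n _ n])
    finally show ?thesis by (simp add: stein)
  qed
  have YX: "trace_mat (Y * X) = trace_mat (X * X)"
    using XY trace_mat_mult_commute[OF Y X] by simp
  have AX_XA: "trace_mat ((X * A)\<^sup>T * (X * A)) = trace_mat (X * X) - trace_mat ((X * B)\<^sup>T * (X * B))"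
  proof -
    have "trace_mat ((X * A)\<^sup>T * (X * A)) = trace_mat ((X * A) * (X * A)\<^sup>T)"
      by (rule trace_mat_mult_commute[of _ n n]) auto
    also have "(X * A) * (X * A)\<^sup>T = X * (A * A\<^sup>T) * X"
      by (simp add: transpose_mult[of _ n n _ n] sym assoc[of _ n n _ n _ n])
    also have "\<dots> = X * X - X * (B * B\<^sup>T) * X"
      by (simp add: AA mult_minus_distrib_mat[of _ n n _ n] minus_mult_distrib_mat[of _ n n _ _ n])
    also have "X * (B * B\<^sup>T) * X = (X * B) * (X * B)\<^sup>T"
      by (simp add: transpose_mult[of _ n n _ d] sym assoc[of _ n n _ n _ n]
          assoc[of _ n d _ n _ n] assoc[of _ n n _ d _ n])
    also have "trace_mat (X * X - \<dots>) = trace_mat (X * X) - trace_mat ((X * B) * (X * B)\<^sup>T)"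
      by (rule trace_mat_minus[of _ n]) auto
    also have "trace_mat ((X * B) * (X * B)\<^sup>T) = trace_mat ((X * B)\<^sup>T * (X * B))"
      by (rule trace_mat_mult_commute[of _ n d]) auto
    finally show ?thesis .
  qed
  have YY: "trace_mat (Y * Y) = trace_mat ((X * A)\<^sup>T * (X * A)) - trace_mat (C\<^sup>T * C)"
  proof -
    have "Y * Y = A\<^sup>T * X * (A * Y)"
      by (simp add: Y_def assoc[of _ n n _ n _ n])
    also have "\<dots> = A\<^sup>T * X * (X * A) - A\<^sup>T * X * (B * C)"
      unfolding AY by (rule mult_minus_distrib_mat[of _ n n _ n]) auto
    also have "A\<^sup>T * X = (X * A)\<^sup>T"
      by (simp add: transpose_mult[of _ n n _ n] sym)
    also have "(X * A)\<^sup>T * (B * C) = ((X * A)\<^sup>T * B) * C"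
      by (simp add: assoc[of _ n n _ d _ n])
    also have "(X * A)\<^sup>T * B = C\<^sup>T"
      by (simp add: C_def transpose_mult[of _ d n _ n] transpose_mult[of _ n n _ n] sym
          assoc[of _ d n _ n _ n] assoc[of _ n n _ n _ d] transpose_mult[of _ d n _ n])
    finally show ?thesis
      by (simp add: trace_mat_minus[of _ n])
  qed
  \<comment> \<open>Both mixed traces equal \<open>trace_mat (X * X)\<close>, so the right side
    reduces to \<open>trace_mat (Y * Y) - trace_mat (X * X)\<close>, which is minus the sum of the
    squared norms of \<open>X * B\<close> and \<open>C\<close>.\<close>
  have "trace_mat ((X - Y)\<^sup>T * (X - Y)) = trace_mat (X * X) - trace_mat (X * Y) - (trace_mat (Y * X) - trace_mat (Y * Y))"
    by (simp add: transpose_minus[of _ n n] sym symY mult_minus_distrib_mat[of _ n n _ n]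
        minus_mult_distrib_mat[of _ n n _ _ n] trace_mat_minus[of _ n] minus_carrier_mat)
  with XY YX YY AX_XA have "trace_mat ((X - Y)\<^sup>T * (X - Y)) + trace_mat ((X * B)\<^sup>T * (X * B))
      + trace_mat (C\<^sup>T * C) = 0"
    by simp
  with trace_transpose_mult_self_nonneg[of "X - Y"] trace_transpose_mult_self_nonneg[of "X * B"]
    trace_transpose_mult_self_nonneg[of C]
  have "trace_mat ((X - Y)\<^sup>T * (X - Y)) = 0" "trace_mat ((X * B)\<^sup>T * (X * B)) = 0"
    "trace_mat (C\<^sup>T * C) = 0"
    by linarith+
  then have zero: "X - Y = 0\<^sub>m n n" "X * B = 0\<^sub>m n d" "C = 0\<^sub>m d n"
    by (auto intro!: trace_transpose_mult_self_eq_0 minus_carrier_mat)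
  show "X * B = 0\<^sub>m n d" by fact
  have "X = Y"
  proof (rule eq_matI)
    fix i j assume "i < dim_row Y" "j < dim_col Y"
    moreover have "(X - Y) $$ (i, j) = 0\<^sub>m n n $$ (i, j)" by (simp add: zero)
    moreover have "dim_row Y = n" "dim_col Y = n" using Y by (auto simp del: Y)
    ultimately show "X $$ (i, j) = Y $$ (i, j)" by simp
  qed (use X Y in \<open>auto simp del: X Y\<close>)
  have "X * A - 0\<^sub>m n n = X * A"
    using A X by (intro eq_matI) (auto simp del: A X)
  with AY \<open>X = Y\<close> zero(3) show "X * A = A * X"
    by (simp add: right_mult_zero_mat[of _ n d])
qed

section \<open>Intertwiners of unreduced Hessenberg matrices\<close>

text \<open>The columns of \<open>X\<close> vanish one after the other. If columns up to
  \<open>j\<close> are zero, column \<open>j\<close> of \<open>M * X\<close> is zero, while column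
  \<open>j\<close> of \<open>X * A\<close> is column \<open>j + 1\<close> of \<open>X\<close> times
  a nonzero subdiagonal entry.\<close>

lemma hessenberg_cyclic_kernel:
  fixes A X :: "'a :: idom mat"
  assumes A: "A \<in> carrier_mat n n" and X: "X \<in> carrier_mat m n" and M: "M \<in> carrier_mat m m"
    and hess: "\<And>i j. i < n \<Longrightarrow> j + 1 < i \<Longrightarrow> A $$ (i, j) = 0"
    and sub: "\<And>i. i + 1 < n \<Longrightarrow> A $$ (i + 1, i) \<noteq> 0"
    and intertwine: "X * A = M * X"
    and first: "\<And>i. i < m \<Longrightarrow> X $$ (i, 0) = 0"
  shows "X = 0\<^sub>m m n"
proof -
  have "\<forall>i<m. X $$ (i, k) = 0" if "k < n" for k
    using that
  proof (induction k rule: less_induct)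
    case (less k)
    show ?case
    proof (cases k)
      case 0
      then show ?thesis using first by simp
    next
      case (Suc j)
      show ?thesis
      proof (intro allI impI)
        fix i assume i: "i < m"
        have "(X * A) $$ (i, j) = (\<Sum>l\<in>{0..<n}. X $$ (i, l) * A $$ (l, j))"
          using A X i less.prems Suc by (simp add: scalar_prod_def)
        also have "\<dots> = (\<Sum>l\<in>{k}. X $$ (i, l) * A $$ (l, j))"
        proof (rule sum.mono_neutral_right)
          show "\<forall>l\<in>{0..<n} - {k}. X $$ (i, l) * A $$ (l, j) = 0"
          proof
            fix l assume l: "l \<in> {0..<n} - {k}"
            then consider "l < k" | "j + 1 < l" using Suc by force
            then show "X $$ (i, l) * A $$ (l, j) = 0"
              using l i hess less.IH by cases auto
          qed
        qed (use less.prems in auto)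
        finally have "(X * A) $$ (i, j) = X $$ (i, k) * A $$ (k, j)" by simp
        moreover have "(M * X) $$ (i, j) = 0"
          using M X i less Suc by (auto simp: scalar_prod_def intro!: sum.neutral)
        ultimately show "X $$ (i, k) = 0"
          using intertwine sub[of j] less.prems Suc by simp
      qed
    qed
  qed
  then show ?thesis
    using X by (intro eq_matI) auto
qed

text \<open>Induction on columns: the Hessenberg shape determines the next column of
  \<open>T\<close> below the diagonal, orthogonality clears it above, and the positive subdiagonals
  exclude the diagonal entry -1.\<close>

lemma orthogonal_hessenberg_intertwiner_is_one:
  fixes A A' T :: "real mat"
  assumes A: "A \<in> carrier_mat n n" and A': "A' \<in> carrier_mat n n" and T: "T \<in> carrier_mat n n"
    and orth: "T\<^sup>T * T = 1\<^sub>m n" "T * T\<^sup>T = 1\<^sub>m n"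
    and hess: "\<And>i j. i < n \<Longrightarrow> j + 1 < i \<Longrightarrow> A $$ (i, j) = 0"
    and hess': "\<And>i j. i < n \<Longrightarrow> j + 1 < i \<Longrightarrow> A' $$ (i, j) = 0"
    and sub: "\<And>i. i + 1 < n \<Longrightarrow> A $$ (i + 1, i) > 0"
    and sub': "\<And>i. i + 1 < n \<Longrightarrow> A' $$ (i + 1, i) > 0"
    and intertwine: "A * T = T * A'"
    and pos: "n > 0 \<Longrightarrow> T $$ (0, 0) > 0"
    and first: "\<And>i. 0 < i \<Longrightarrow> i < n \<Longrightarrow> T $$ (i, 0) = 0"
  shows "T = 1\<^sub>m n"
proof -
  have col_norm: "(\<Sum>i\<in>{0..<n}. (T $$ (i, j))\<^sup>2) = 1" if "j < n" for j
  proof -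
    have "(T\<^sup>T * T) $$ (j, j) = 1" using that orth by simp
    then show ?thesis using that T by (simp add: scalar_prod_def power2_eq_square)
  qed
  have row_norm: "(\<Sum>j\<in>{0..<n}. (T $$ (i, j))\<^sup>2) = 1" if "i < n" for i
  proof -
    have "(T * T\<^sup>T) $$ (i, i) = 1" using that orth by simp
    then show ?thesis using that T by (simp add: scalar_prod_def power2_eq_square)
  qed
  have diag: "T $$ (k, k) = 1"
    if k: "k < n" and off: "\<And>i. i < n \<Longrightarrow> i \<noteq> k \<Longrightarrow> T $$ (i, k) = 0" and p: "T $$ (k, k) > 0" for k
  proof -
    have "(\<Sum>i\<in>{0..<n}. (T $$ (i, k))\<^sup>2) = (\<Sum>i\<in>{k}. (T $$ (i, k))\<^sup>2)"
      by (rule sum.mono_neutral_right) (use k off in auto)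
    with col_norm[OF k] p show ?thesis by (simp add: power2_eq_1_iff)
  qed
  have row_zero: "T $$ (k, j) = 0" if k: "k < n" and kk: "T $$ (k, k) = 1" and j: "j < n" "j \<noteq> k" for k j
  proof -
    have "(\<Sum>l\<in>{0..<n} - {k}. (T $$ (k, l))\<^sup>2) = 0"
      using row_norm[OF k] kk k by (simp add: sum_diff1)
    then have "\<forall>l\<in>{0..<n} - {k}. (T $$ (k, l))\<^sup>2 = 0"
      by (subst (asm) sum_nonneg_eq_0_iff) auto
    with j show ?thesis by simp
  qed
  have "\<forall>i<n. T $$ (i, k) = (if i = k then 1 else 0)" if "k < n" for k
    using that
  proof (induction k rule: less_induct)
    case (less k)
    have "(\<forall>i<n. i \<noteq> k \<longrightarrow> T $$ (i, k) = 0) \<and> T $$ (k, k) > 0"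
    proof (cases k)
      case 0
      then show ?thesis using first pos less.prems by auto
    next
      case (Suc j)
      then have j: "j < n" using less.prems by simp
      \<comment> \<open>Column \<open>i\<close> is already a basis vector, so the diagonal entry 1
        uses up the whole norm of row \<open>i\<close>.\<close>
      have upper: "T $$ (i, k) = 0" if "i < k" for i
        using row_zero[of i k] less that by simp
      \<comment> \<open>Entry \<open>(i, j)\<close> of the intertwining relation. On the left,
        column \<open>j\<close> of \<open>T\<close> is a basis vector. On the right, terms with
        \<open>l < k\<close> vanish because \<open>i\<close> lies below the diagonal of the earlier
        columns, and terms with \<open>l > k\<close> vanish by \<open>hess'\<close>.\<close>
      have lower: "A $$ (i, j) = T $$ (i, k) * A' $$ (k, j)" if i: "k \<le> i" "i < n" for i
      proof -
        have "(A * T) $$ (i, j) = (\<Sum>l\<in>{0..<n}. A $$ (i, l) * T $$ (l, j))"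
          using A T i j by (simp add: scalar_prod_def)
        also have "\<dots> = (\<Sum>l\<in>{j}. A $$ (i, l) * T $$ (l, j))"
          by (rule sum.mono_neutral_right) (use j Suc less.IH in auto)
        also have "\<dots> = A $$ (i, j)" using less.IH[of j] j Suc by simp
        finally have AT: "(A * T) $$ (i, j) = A $$ (i, j)" .
        have "(T * A') $$ (i, j) = (\<Sum>l\<in>{0..<n}. T $$ (i, l) * A' $$ (l, j))"
          using A' T i j by (simp add: scalar_prod_def)
        also have "\<dots> = (\<Sum>l\<in>{k}. T $$ (i, l) * A' $$ (l, j))"
        proof (rule sum.mono_neutral_right)
          show "\<forall>l\<in>{0..<n} - {k}. T $$ (i, l) * A' $$ (l, j) = 0"
          proof
            fix l assume l: "l \<in> {0..<n} - {k}"
            then consider "l < k" | "j + 1 < l" using Suc by force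
            then show "T $$ (i, l) * A' $$ (l, j) = 0"
              using l i hess' less.IH by cases auto
          qed
        qed (use less.prems in auto)
        finally show ?thesis using AT intertwine by simp
      qed
      have subk: "A $$ (k, j) > 0" "A' $$ (k, j) > 0"
        using sub[of j] sub'[of j] less.prems Suc by auto
      have "T $$ (i, k) = 0" if "i < n" "i \<noteq> k" for i
      proof (cases "i < k")
        case False
        then have "T $$ (i, k) * A' $$ (k, j) = 0"
          using lower[of i] hess[of i j] that Suc by simp
        with subk show ?thesis by simp
      qed (rule upper)
      moreover have "T $$ (k, k) > 0"
        using lower[of k] subk less.prems by (simp add: zero_less_mult_iff)
      ultimately show ?thesis by blast
    qed
    with diag[OF less.prems] show ?case by auto
  qed
  then show ?thesis
    using T by (intro eq_matI) auto
qed

section \<open>Equivalence of input normal pairs\<close>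

text \<open>Conjugating the second normalisation by \<open>T\<close> shows that
  \<open>T * T\<^sup>T\<close> solves \<open>A * P * A\<^sup>T + B * B\<^sup>T = P\<close>. The
  identity solves the same equation, so the difference solves the homogeneous one.\<close>

lemma input_normal_equivalence_stein:
  fixes A A' B B' T :: "real mat"
  assumes A[simp]: "A \<in> carrier_mat n n" and B[simp]: "B \<in> carrier_mat n d"
    and A'[simp]: "A' \<in> carrier_mat n n" and B'[simp]: "B' \<in> carrier_mat n d"
    and T[simp]: "T \<in> carrier_mat n n"
    and AT: "A * T = T * A'" and BT: "B = T * B'"
    and normal: "A * A\<^sup>T + B * B\<^sup>T = 1\<^sub>m n" and normal': "A' * A'\<^sup>T + B' * B'\<^sup>T = 1\<^sub>m n"
  shows "A * (T * T\<^sup>T - 1\<^sub>m n) * A\<^sup>T = T * T\<^sup>T - 1\<^sub>m n"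
proof -
  note assoc = assoc_mult_mat
  note [simp] = mult_carrier_mat[of _ n n _ n] mult_carrier_mat[of _ n n _ d]
    mult_carrier_mat[of _ n d _ n] mult_carrier_mat[of _ d n _ n]
    left_mult_one_mat[of _ n n] right_mult_one_mat[of _ n n]
  have "A * (T * T\<^sup>T) * A\<^sup>T = (A * T) * (A * T)\<^sup>T"
    by (simp add: transpose_mult[of _ n n _ n] assoc[of _ n n _ n _ n])
  also have "\<dots> = T * (A' * A'\<^sup>T) * T\<^sup>T"
    unfolding AT by (simp add: transpose_mult[of _ n n _ n] assoc[of _ n n _ n _ n])
  finally have 1: "A * (T * T\<^sup>T) * A\<^sup>T = T * (A' * A'\<^sup>T) * T\<^sup>T" .
  have 2: "B * B\<^sup>T = T * (B' * B'\<^sup>T) * T\<^sup>T"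
    unfolding BT by (simp add: transpose_mult[of _ n n _ d] assoc[of _ n n _ n _ n]
        assoc[of _ n d _ n _ n] assoc[of _ n n _ d _ n])
  have "A * (T * T\<^sup>T) * A\<^sup>T + B * B\<^sup>T = T * (A' * A'\<^sup>T + B' * B'\<^sup>T) * T\<^sup>T"
    unfolding 1 2
    by (simp add: mult_add_distrib_mat[of _ n n _ n] add_mult_distrib_mat[of _ n n _ _ n])
  then have 3: "A * (T * T\<^sup>T) * A\<^sup>T + B * B\<^sup>T = T * T\<^sup>T"
    by (simp add: normal')
  have "A * (T * T\<^sup>T - 1\<^sub>m n) * A\<^sup>T = A * (T * T\<^sup>T) * A\<^sup>T - A * A\<^sup>T"
    by (simp add: mult_minus_distrib_mat[of _ n n _ n] minus_mult_distrib_mat[of _ n n _ _ n])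
  also have "\<dots> = (A * (T * T\<^sup>T) * A\<^sup>T + B * B\<^sup>T) - (A * A\<^sup>T + B * B\<^sup>T)"
    using A B T by (intro eq_matI) (auto simp del: A B T)
  finally show ?thesis by (simp add: 3 normal)
qed

theorem corollary2p6:
  fixes A A' B B' :: "real mat" and n d :: nat
  assumes "n \<ge> 1" and "d \<ge> 1"
    and "A \<in> carrier_mat n n" and "B \<in> carrier_mat n d"
    and "HIN_pair A B" and "strict_pair A B" and "nondegenerate_pair A B"
    and "A' \<in> carrier_mat n n" and "B' \<in> carrier_mat n d"
    and "HIN_pair A' B'" and "strict_pair A' B'"
    and "equivalent_pairs A B A' B'"
  shows "A' = A \<and> B' = B"
proof -
  note A[simp] = assms(3) and B[simp] = assms(4) and A'[simp] = assms(8) and B'[simp] = assms(9)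
  have dims[simp]: "dim_row A = n" "dim_col A = n" "dim_row B = n"
    "dim_row A' = n" "dim_col A' = n" "dim_row B' = n"
    using A B A' B' by (auto simp del: A B A' B')
  note [simp] = mult_carrier_mat[of _ n n _ n] mult_carrier_mat[of _ n n _ d]
    left_mult_one_mat[of _ n n] right_mult_one_mat[of _ n n] left_mult_one_mat[of _ n d]
  obtain T S where T[simp]: "T \<in> carrier_mat n n" and S[simp]: "S \<in> carrier_mat n n"
    and TS: "T * S = 1\<^sub>m n" and ST: "S * T = 1\<^sub>m n" and A'_eq: "A' = S * A * T" and B'_eq: "B' = S * B"
    using assms(12) by (auto simp: equivalent_pairs_def inverts_mat_def)
  have [simp]: "dim_row T = n" "dim_col T = n" using T by (auto simp del: T)
  have hess: "A $$ (i, j) = 0" "A' $$ (i, j) = 0" if "i < n" "j + 1 < i" for i j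
    using assms(5,10) that by (auto simp: HIN_pair_def hessenberg_pair_def hessenberg_mat_def)
  have sub: "A $$ (i + 1, i) > 0" "A' $$ (i + 1, i) > 0" if "i + 1 < n" for i
    using assms(6,11) that
    by (auto simp: strict_pair_def unreduced_pair_def standard_pair_def order.strict_iff_order)
  have b: "B $$ (0, 0) > 0" "B' $$ (0, 0) > 0"
    using assms(6,11) by (auto simp: strict_pair_def unreduced_pair_def standard_pair_def)
  have b0: "B $$ (i, 0) = 0" "B' $$ (i, 0) = 0" if "0 < i" "i < n" for i
    using assms(5,10) that by (auto simp: HIN_pair_def hessenberg_pair_def)
  have normal: "A * A\<^sup>T + B * B\<^sup>T = 1\<^sub>m n" "A' * A'\<^sup>T + B' * B'\<^sup>T = 1\<^sub>m n"
    using assms(5,10) by (auto simp: HIN_pair_def input_normal_def)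
  have "T * A' = (T * S) * (A * T)"
    by (simp add: A'_eq assoc_mult_mat[of _ n n _ n _ n])
  then have AT: "A * T = T * A'"
    by (simp add: TS)
  have "T * B' = (T * S) * B"
    by (simp add: B'_eq assoc_mult_mat[of _ n n _ n _ d])
  then have BT: "B = T * B'"
    by (simp add: TS)
  \<comment> \<open>The first column of \<open>B\<close> or \<open>B'\<close> is a multiple of the
    first basis vector, so multiplication by it reads off the first column of \<open>M\<close>. The
    column exists since \<open>d \<ge> 1\<close>.\<close>
  have first_col: "(M * N) $$ (i, 0) = M $$ (i, 0) * N $$ (0, 0)"
    if "i < n" "M \<in> carrier_mat n n" "N \<in> carrier_mat n d" "\<And>i. 0 < i \<Longrightarrow> i < n \<Longrightarrow> N $$ (i, 0) = 0"
    for M N :: "real mat" and i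
  proof -
    have "(M * N) $$ (i, 0) = (\<Sum>l\<in>{0..<n}. M $$ (i, l) * N $$ (l, 0))"
      using that assms(2) by (simp add: scalar_prod_def)
    also have "\<dots> = (\<Sum>l\<in>{0}. M $$ (i, l) * N $$ (l, 0))"
      by (rule sum.mono_neutral_right) (use that assms(1) in auto)
    finally show ?thesis by simp
  qed
  define X where "X = T * T\<^sup>T - 1\<^sub>m n"
  have X[simp]: "X \<in> carrier_mat n n"
    by (simp add: X_def minus_carrier_mat)
  have "X\<^sup>T = X"
    by (simp add: X_def transpose_minus[of _ n n] transpose_mult[of _ n n _ n])
  moreover have "A * X * A\<^sup>T = X"
    unfolding X_def by (rule input_normal_equivalence_stein[OF A B A' B' T AT BT normal])
  ultimately have XB: "X * B = 0\<^sub>m n d" and XA: "X * A = A * X"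
    using symmetric_stein_solution_commutes[OF A B X normal(1)] by auto
  have "X = 0\<^sub>m n n"
  \<comment> \<open>Here \<open>M\<close> is \<open>A\<close> itself. The first column of
    \<open>X\<close> vanishes because \<open>X * B = 0\<^sub>m n d\<close> and
    \<open>B $$ (0, 0)\<close> is positive.\<close>
  proof (rule hessenberg_cyclic_kernel[OF A X A hess(1) _ XA])
    fix i assume i: "i < n"
    then show "X $$ (i, 0) = 0"
      using first_col[OF i X B b0(1)] XB b assms(2) by simp
  qed (use sub in force)+
  have TT: "T * T\<^sup>T = 1\<^sub>m n"
  proof (rule eq_matI)
    fix i j assume ij: "i < dim_row (1\<^sub>m n :: real mat)" "j < dim_col (1\<^sub>m n :: real mat)"
    have "X $$ (i, j) = 0" using ij \<open>X = 0\<^sub>m n n\<close> by simp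
    then show "(T * T\<^sup>T) $$ (i, j) = 1\<^sub>m n $$ (i, j)" using ij by (simp add: X_def)
  qed auto
  \<comment> \<open>\<open>T\<^sup>T\<close> is a right inverse of \<open>T\<close>, hence equals
    the two-sided inverse \<open>S\<close>.\<close>
  have "S = S * (T * T\<^sup>T)" by (simp add: TT)
  also have "\<dots> = T\<^sup>T"
    using ST by (simp flip: assoc_mult_mat[of _ n n _ n _ n])
  finally have TT': "T\<^sup>T * T = 1\<^sub>m n" using ST by simp
  have "T = 1\<^sub>m n"
  proof (rule orthogonal_hessenberg_intertwiner_is_one[OF A A' T TT' TT hess sub AT])
    \<comment> \<open>Column 0 of \<open>B = T * B'\<close> starts the induction: \<open>T\<close>
      maps the first basis vector to a positive multiple of itself.\<close>
    have "B $$ (0, 0) = T $$ (0, 0) * B' $$ (0, 0)"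
      using first_col[OF _ T B' b0(2), of 0] BT assms(1) by simp
    with b show "T $$ (0, 0) > 0" by (simp add: zero_less_mult_iff)
  next
    fix i assume i: "0 < i" "i < n"
    have "B $$ (i, 0) = T $$ (i, 0) * B' $$ (0, 0)"
      using first_col[OF i(2) T B' b0(2)] BT by simp
    with b b0(1)[OF i] show "T $$ (i, 0) = 0" by simp
  qed
  then show ?thesis
    using AT BT by simp
qed

end
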